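(* Fix a real number $a\ge0$ and let $G=(V,E)$ be a finite simple graph with $V\ne\emptyset$ and average degree $d$, such that $\operatorname{mad}(G[N(v)])\le a$ for all $v\in V$. If $0\le\lambda\le2(a+1)$, then $$\frac1{|V|}\log Z_G(\lambda)\ge\frac{\mathcal A(W(\lambda d))-\mathcal A(W(\lambda(a+2)))}{d-(a+2)},$$ where at $d=a+2$ the quotient is interpreted by continuity as $W(\lambda(a+2))/(a+2)$.
   Context: All graphs are finite and simple; $\log$ is the natural logarithm. $N(v)$ is the set of neighbors of $v$. The average degree is $d=2|E|/|V|$. $Z_G(\lambda)=\sum_{I\in\mathcal I(G)}\lambda^{|I|}$, where $\mathcal I(G)$ is the set of independent sets of $G$ including $\emptyset$. $\operatorname{mad}(H)=\max_{H'\subseteq H}2|E(H')|/|V(H')|$ (maximum over subgraphs $H'$ with at least one vertex), with $\operatorname{mad}(H)=0$ if $H$ has no vertices. $\mathcal A(x)=x^2/2+x$. $W$ is the principal nonnegative branch of the Lambert function: for $z\ge0$, $W(z)\ge0$ and $W(z)e^{W(z)}=z$. *)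

theory Defs
  imports Complex_Main
begin

type_synonym 'a edge = "'a set"

definition simple_graph :: "'a set \<Rightarrow> 'a edge set \<Rightarrow> bool" where
  "simple_graph V E \<longleftrightarrow> finite V \<and> (\<forall>e\<in>E. e \<subseteq> V \<and> card e = 2)"

definition neighbors :: "'a edge set \<Rightarrow> 'a \<Rightarrow> 'a set" where
  "neighbors E v = {u. {u, v} \<in> E}"

definition induced_edges :: "'a edge set \<Rightarrow> 'a set \<Rightarrow> 'a edge set" where
  "induced_edges E U = {e \<in> E. e \<subseteq> U}"

definition average_degree :: "'a set \<Rightarrow> 'a edge set \<Rightarrow> real" where
  "average_degree V E = 2 * real (card E) / real (card V)"

definition nonempty_subgraphs :: "'a set \<Rightarrow> 'a edge set \<Rightarrow> ('a set \<times> 'a edge set) set" where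
  "nonempty_subgraphs V E = {(U, F). U \<noteq> {} \<and> U \<subseteq> V \<and> F \<subseteq> E \<and> simple_graph U F}"

definition mad :: "'a set \<Rightarrow> 'a edge set \<Rightarrow> real" where
  "mad V E = (if V = {} then 0
     else Max ((\<lambda>(U, F). average_degree U F) ` nonempty_subgraphs V E))"

definition independent_sets :: "'a set \<Rightarrow> 'a edge set \<Rightarrow> 'a set set" where
  "independent_sets V E = {I. I \<subseteq> V \<and> (\<forall>u\<in>I. \<forall>v\<in>I. {u, v} \<notin> E)}"

definition indep_poly :: "'a set \<Rightarrow> 'a edge set \<Rightarrow> real \<Rightarrow> real" where
  "indep_poly V E lam = (\<Sum>I\<in>independent_sets V E. lam ^ card I)"

(* Principal branch of the Lambert function; only meaningful for arguments z >= 0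
   (see lambert_W_ex1 below). *)
definition lambert_W :: "real \<Rightarrow> real" where
  "lambert_W z = (THE w. 0 \<le> w \<and> w * exp w = z)"

definition calA :: "real \<Rightarrow> real" where
  "calA x = x\<^sup>2 / 2 + x"

(* The difference quotient of x |-> calA (lambert_W (lam * x)) between b and d. At d = b it is
   extended by continuity: W'(z) = W(z) / (z (1 + W(z))) gives the derivative W(lam b) / b. *)
definition W_quotient :: "real \<Rightarrow> real \<Rightarrow> real \<Rightarrow> real" where
  "W_quotient lam d b =
     (if d = b then lambert_W (lam * b) / b
      else (calA (lambert_W (lam * d)) - calA (lambert_W (lam * b))) / (d - b))"

lemma lambert_W_ex1:
  fixes z :: real
  assumes "0 \<le> z"
  shows "\<exists>!w. 0 \<le> w \<and> w * exp w = z"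
proof -
  have mono: "x * exp x < y * exp y" if "0 \<le> x" "x < y" for x y :: real
    using that by (intro mult_strict_mono) auto
  have "\<exists>w\<ge>0. w \<le> z \<and> w * exp w = z"
  proof (rule IVT')
    show "z \<le> z * exp z"
      using assms by (simp add: mult_le_cancel_left1)
  qed (use assms in \<open>auto intro!: continuous_intros\<close>)
  then show ?thesis
    by (metis less_irrefl linorder_neqE_linordered_idom mono)
qed

lemma lambert_W:
  assumes "0 \<le> z"
  shows "0 \<le> lambert_W z" and "lambert_W z * exp (lambert_W z) = z"
  using theI'[OF lambert_W_ex1[OF assms]] unfolding lambert_W_def by auto

lemma finite_edges: "simple_graph V E \<Longrightarrow> finite E"
  unfolding simple_graph_def by (rule finite_subset[of _ "Pow V"]) auto

lemma finite_nonempty_subgraphs: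
  assumes "simple_graph V E"
  shows "finite (nonempty_subgraphs V E)"
  using assms finite_edges[OF assms]
  by (intro finite_subset[of "nonempty_subgraphs V E" "Pow V \<times> Pow E"])
     (auto simp: nonempty_subgraphs_def simple_graph_def)

lemma nonempty_subgraphs_nonempty:
  assumes "simple_graph V E" and "V \<noteq> {}"
  shows "(V, E) \<in> nonempty_subgraphs V E"
  using assms by (simp add: nonempty_subgraphs_def)

end

theory Submission
  imports Defs "HOL-Analysis.Analysis"
begin

text \<open>
  Let \<open>b = a + 2\<close>, let \<open>h(x) = \<lambda>e\<^bsup>-W(\<lambda>x)\<^esup>\<close>, which is \<open>W(\<lambda>x)/x\<close> for \<open>x > 0\<close>, and let
  \<open>f(d) = W_quotient \<lambda> d b\<close>. Since \<open>h\<close> is the derivative of \<open>x \<mapsto> \<A>(W(\<lambda>x))\<close>, the value \<open>f(d)\<close> is the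
  average of \<open>h\<close> between \<open>b\<close> and \<open>d\<close>. As \<open>h\<close> is convex and decreasing, so is \<open>f\<close>, and its gradient
  \<open>s\<close> at \<open>d\<close> satisfies \<open>f(d) + (d - b) s = h(d)\<close> (\<open>W_quotient_tangent\<close>).

  The bound \<open>Z \<ge> e\<^bsup>n f(d)\<^esup>\<close> is proved for every induced subgraph, with \<open>n\<close> vertices and average
  degree \<open>d\<close>, by induction through the recurrence \<open>Z(G) = Z(G - v) + \<lambda> Z(G - N[v])\<close> averaged over all
  vertices \<open>v\<close>. Bounding \<open>f\<close> below by its tangent at \<open>d\<close> lets Jensen's inequality for \<open>exp\<close> and the
  Cauchy-Schwarz inequality for the degrees perform the averaging; sparsity of the neighbourhoods
  bounds the number of edges that
  survive the removal of \<open>N[v]\<close> (\<open>shearer_induction\<close>). What remains is one inequality between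
  \<open>f(d)\<close> and \<open>s\<close>, which simplifies to \<open>h + bs \<le> ln (1 + h)\<close> at \<open>h = h(d)\<close>.

  By \<open>ln (1 + h) \<ge> 2h/(2 + h)\<close> it is enough that \<open>-bs (2 + h) \<ge> h\<^sup>2\<close>. In the variables \<open>W(\<lambda>b)\<close> and
  \<open>W(\<lambda>b) - W(\<lambda>d)\<close> this is an elementary inequality whose defect has a derivative of constant sign
  on either side of its zero at \<open>d = b\<close>, and the hypothesis \<open>\<lambda> \<le> 2(b - 1)\<close> is what fixes that sign
  (\<open>exp_remainder_square_bound\<close>).
\<close>

section \<open>The Lambert function on the nonnegative half-line\<close>

lemma lambert_W_eqI:
  assumes "0 \<le> w" and "w * exp w = z"
  shows "lambert_W z = w"
proof -
  have "0 \<le> z"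
    using assms by auto
  then show ?thesis
    using lambert_W_ex1[OF \<open>0 \<le> z\<close>] lambert_W[OF \<open>0 \<le> z\<close>] assms by blast
qed

lemma mult_exp_diff_ge:
  fixes p q :: real
  assumes "0 \<le> q" and "q \<le> p"
  shows "p - q \<le> p * exp p - q * exp q"
proof -
  have "p * exp p - q * exp q = (p - q) * exp p + q * (exp p - exp q)"
    by (simp add: algebra_simps)
  moreover have "p - q \<le> (p - q) * exp p"
    using mult_left_mono[of 1 "exp p" "p - q"] assms by simp
  moreover have "0 \<le> q * (exp p - exp q)"
    using assms by auto
  ultimately show ?thesis
    using add_mono by fastforce
qed

text \<open>
  The inverse \<open>w \<mapsto> w e\<^sup>w\<close> expands distances on \<open>w \<ge> 0\<close>, so \<open>W\<close> is a contraction. This gives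
  continuity up to and including the endpoint \<open>0\<close>, where no two-sided derivative is available.
\<close>

lemma lambert_W_diff_le:
  assumes "0 \<le> x" and "0 \<le> y"
  shows "\<bar>lambert_W x - lambert_W y\<bar> \<le> \<bar>x - y\<bar>"
  using mult_exp_diff_ge[of "lambert_W x" "lambert_W y"]
    mult_exp_diff_ge[of "lambert_W y" "lambert_W x"]
    lambert_W[OF assms(1)] lambert_W[OF assms(2)]
  by (cases "lambert_W x \<le> lambert_W y") auto

lemma continuous_on_lambert_W: "continuous_on {0..} lambert_W"
  unfolding continuous_on_iff dist_real_def
  by (metis atLeast_iff lambert_W_diff_le order.strict_trans1)

lemma DERIV_lambert_W:
  assumes "0 < z"
  shows "(lambert_W has_real_derivative exp (- lambert_W z) / (1 + lambert_W z)) (at z)"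
proof -
  have "isCont lambert_W z"
    using continuous_on_interior[OF continuous_on_lambert_W] assms by simp
  moreover have "((\<lambda>w. w * exp w) has_real_derivative
      exp (lambert_W z) * (1 + lambert_W z)) (at (lambert_W z))"
    by (auto intro!: derivative_eq_intros simp: algebra_simps)
  moreover have "exp (lambert_W z) * (1 + lambert_W z) \<noteq> 0"
    using lambert_W(1)[of z] assms by auto
  ultimately have "(lambert_W has_real_derivative
      inverse (exp (lambert_W z) * (1 + lambert_W z))) (at z)"
    using assms by (intro DERIV_inverse_function[where a = 0 and b = "z + 1"]) (auto simp: lambert_W)
  then show ?thesis
    by (simp add: exp_minus field_simps)
qed

section \<open>The quotient as an average of a convex slope\<close>

text \<open>
  The derivative of \<open>x \<mapsto> \<A>(W(\<lambda>x))\<close>. It equals \<open>W(\<lambda>x)/x\<close> for \<open>x > 0\<close>; the exponential form also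
  covers \<open>x = 0\<close>, where the slope is \<open>\<lambda>\<close>.
\<close>

definition W_slope :: "real \<Rightarrow> real \<Rightarrow> real" where
  "W_slope lam x = lam * exp (- lambert_W (lam * x))"

text \<open>The derivative of \<open>W_slope lam\<close>, that is, the second derivative of \<open>x \<mapsto> \<A>(W(\<lambda>x))\<close>.\<close>

definition W_slope_deriv :: "real \<Rightarrow> real \<Rightarrow> real" where
  "W_slope_deriv lam x = - (W_slope lam x)\<^sup>2 / (1 + lambert_W (lam * x))"

lemma W_slope_nonneg: "0 \<le> lam \<Longrightarrow> 0 \<le> W_slope lam x"
  by (simp add: W_slope_def)

lemma mult_W_slope:
  assumes "0 \<le> lam" and "0 \<le> x"
  shows "x * W_slope lam x = lambert_W (lam * x)"
  using lambert_W(2)[of "lam * x"] assms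
  by (simp add: W_slope_def exp_minus field_simps)

lemma W_slope_deriv_nonpos:
  assumes "0 \<le> lam" and "0 \<le> x"
  shows "W_slope_deriv lam x \<le> 0"
  using lambert_W(1)[of "lam * x"] assms by (simp add: W_slope_deriv_def)

lemma DERIV_lambert_W_scaled:
  assumes "0 < lam" and "0 < x"
  shows "((\<lambda>x. lambert_W (lam * x)) has_real_derivative
      W_slope lam x / (1 + lambert_W (lam * x))) (at x)"
proof -
  have "0 < lam * x"
    using assms by simp
  then have "((\<lambda>x. lambert_W (lam * x)) has_real_derivative
      exp (- lambert_W (lam * x)) / (1 + lambert_W (lam * x)) * lam) (at x)"
    by (rule DERIV_chain2[OF DERIV_lambert_W]) (auto intro!: derivative_eq_intros)
  then show ?thesis
    by (simp add: W_slope_def mult.commute)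
qed

lemma DERIV_calA_lambert_W:
  assumes "0 < lam" and "0 < x"
  shows "((\<lambda>x. calA (lambert_W (lam * x))) has_real_derivative W_slope lam x) (at x)"
proof -
  have "0 \<le> lambert_W (lam * x)"
    using assms by (simp add: lambert_W)
  then show ?thesis
    unfolding calA_def
    by (auto intro!: derivative_eq_intros DERIV_lambert_W_scaled[OF assms] simp: divide_simps)
      (simp add: algebra_simps)
qed

lemma DERIV_W_slope:
  assumes "0 < lam" and "0 < x"
  shows "(W_slope lam has_real_derivative W_slope_deriv lam x) (at x)"
proof -
  have "((\<lambda>x. lam * exp (- lambert_W (lam * x))) has_real_derivative W_slope_deriv lam x) (at x)"
    by (auto intro!: derivative_eq_intros DERIV_lambert_W_scaled[OF assms]
        simp: W_slope_deriv_def W_slope_def power2_eq_square)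
  then show ?thesis
    by (simp add: W_slope_def[abs_def])
qed

lemma continuous_on_lambert_W_scaled [continuous_intros]:
  fixes g :: "'a :: topological_space \<Rightarrow> real"
  assumes "0 \<le> lam" and "continuous_on S g" and "\<And>t. t \<in> S \<Longrightarrow> 0 \<le> g t"
  shows "continuous_on S (\<lambda>t. lambert_W (lam * g t))"
proof (rule continuous_on_compose2[OF continuous_on_lambert_W])
  show "continuous_on S (\<lambda>t. lam * g t)"
    using assms(2) by (intro continuous_intros)
  show "(\<lambda>t. lam * g t) ` S \<subseteq> {0..}"
    using assms by auto
qed

lemma continuous_on_W_slope [continuous_intros]:
  assumes "0 \<le> lam" and "continuous_on S g" and "\<And>t. t \<in> S \<Longrightarrow> 0 \<le> g t"
  shows "continuous_on S (\<lambda>t. W_slope lam (g t))"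
  unfolding W_slope_def using assms by (intro continuous_intros)

lemma continuous_on_W_slope_deriv [continuous_intros]:
  assumes "0 \<le> lam" and "continuous_on S g" and "\<And>t. t \<in> S \<Longrightarrow> 0 \<le> g t"
  shows "continuous_on S (\<lambda>t. W_slope_deriv lam (g t))"
proof -
  have "1 + lambert_W (lam * g t) \<noteq> 0" if "t \<in> S" for t
    using lambert_W(1)[of "lam * g t"] assms(1) assms(3)[OF that] by simp
  then show ?thesis
    unfolding W_slope_deriv_def using assms by (intro continuous_intros) auto
qed

text \<open>
  Convexity of the slope. With \<open>q = W(\<lambda>y)\<close> and \<open>r = W(\<lambda>x) - W(\<lambda>y)\<close>, division by the slope at \<open>y\<close>
  turns the tangent inequality into
  \<open>q (e\<^sup>r + e\<^bsup>-r\<^esup> - 2) + (r e\<^sup>r + e\<^bsup>-r\<^esup> - 1) \<ge> 0\<close>, and both summands are nonnegative.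
\<close>

lemma W_slope_above_tangent:
  assumes lam: "0 < lam" and x: "0 \<le> x" and y: "0 \<le> y"
  shows "W_slope lam y + W_slope_deriv lam y * (x - y) \<le> W_slope lam x"
proof -
  define p q where "p = lambert_W (lam * x)" and "q = lambert_W (lam * y)"
  define r where "r = p - q"
  have q: "0 \<le> q" and pq: "lam * x = p * exp p" "lam * y = q * exp q"
    using assms by (simp_all add: p_def q_def lambert_W)
  have "0 \<le> r * (exp r - 1)"
    by (cases "0 \<le> r") (auto intro: mult_nonneg_nonneg mult_nonpos_nonpos)
  moreover have "1 - r \<le> exp (- r)"
    using exp_ge_add_one_self[of "- r"] by simp
  ultimately have 1: "1 \<le> r * exp r + exp (- r)"
    by (simp add: algebra_simps)
  have "2 \<le> exp r + exp (- r)"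
    using cosh_real_ge_1[of r] by (simp add: cosh_field_def)
  then have "0 \<le> q * (exp r + exp (- r) - 2)"
    using q by simp
  with 1 have *: "1 + 2 * q \<le> (1 + q) * exp (- r) + (q + r) * exp r"
    by (simp add: algebra_simps)
  have e: "W_slope lam y * lam * (x - y) = lam * ((q + r) * exp r - q)"
  proof -
    have "W_slope lam y * lam * (x - y) = lam * exp (- q) * (p * exp p - q * exp q)"
      by (simp add: W_slope_def q_def[symmetric] pq[symmetric] algebra_simps)
    also have "\<dots> = lam * ((q + r) * exp r - q)"
      by (simp add: r_def exp_diff exp_minus field_simps)
    finally show ?thesis .
  qed
  have "W_slope lam y + W_slope_deriv lam y * (x - y)
      = W_slope lam y * (1 - (W_slope lam y * lam * (x - y)) / lam / (1 + q))"
  proof -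
    have "W_slope lam y * lam * (x - y) / lam = W_slope lam y * (x - y)"
      using lam by simp
    show ?thesis
      unfolding \<open>W_slope lam y * lam * (x - y) / lam = _\<close>
      by (simp add: W_slope_deriv_def q_def[symmetric] power2_eq_square right_diff_distrib
          diff_divide_distrib mult.assoc)
  qed
  also have "\<dots> = W_slope lam y * (1 - ((q + r) * exp r - q) / (1 + q))"
    unfolding e using lam by simp
  also have "\<dots> \<le> W_slope lam y * exp (- r)"
    using * q lam by (intro mult_left_mono W_slope_nonneg) (auto simp: field_simps)
  also have "\<dots> = W_slope lam x"
    by (simp add: W_slope_def p_def[symmetric] q_def[symmetric] r_def mult_exp_exp)
  finally show ?thesis .
qed

lemma segment_nonneg:
  fixes b t x :: real
  assumes "0 \<le> b" and "0 \<le> x" and "t \<in> {0..1}"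
  shows "0 \<le> b + t * (x - b)"
proof -
  have "b + t * (x - b) = (1 - t) * b + t * x"
    by (simp add: algebra_simps)
  then show ?thesis
    using assms by simp
qed

lemma segment_pos:
  fixes b t x :: real
  assumes "0 < b" and "0 \<le> x" and "t \<in> {0<..<1}"
  shows "0 < b + t * (x - b)"
proof -
  have "b + t * (x - b) = (1 - t) * b + t * x"
    by (simp add: algebra_simps)
  then show ?thesis
    using assms by (simp add: add_pos_nonneg)
qed

text \<open>
  A difference quotient is the average of the derivative over the interval between the two points.
  In this form the removable singularity at \<open>x = b\<close> disappears, and convexity and monotonicity in
  \<open>x\<close> can be read off the integrand.
\<close>

lemma W_quotient_has_integral:
  assumes lam: "0 < lam" and b: "0 < b" and x: "0 \<le> x"
  shows "((\<lambda>t. W_slope lam (b + t * (x - b))) has_integral W_quotient lam x b) {0..1}"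
proof (cases "x = b")
  case True
  have "W_slope lam b = lambert_W (lam * b) / b"
    using mult_W_slope[of lam b] lam b by (simp add: field_simps)
  then show ?thesis
    using True has_integral_const_real[of "W_slope lam b" 0 1] by (simp add: W_quotient_def)
next
  case False
  have pos: "0 \<le> b + t * (x - b)" if "t \<in> {0..1}" for t
    using segment_nonneg[OF less_imp_le[OF b] x that] .
  have pos': "0 < b + t * (x - b)" if "t \<in> {0<..<1}" for t
    using segment_pos[OF b x that] .
  let ?g = "\<lambda>t. calA (lambert_W (lam * (b + t * (x - b)))) / (x - b)"
  have "((\<lambda>t. W_slope lam (b + t * (x - b))) has_integral (?g 1 - ?g 0)) {0..1}"
  proof (rule fundamental_theorem_of_calculus_interior)
    show "continuous_on {0..1} ?g"
      unfolding calA_def using lam pos False by (intro continuous_intros) auto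
    show "(?g has_vector_derivative W_slope lam (b + t * (x - b))) (at t)" if "t \<in> {0<..<1}" for t
    proof -
      have "((\<lambda>t. b + t * (x - b)) has_real_derivative (x - b)) (at t)"
        by (auto intro!: derivative_eq_intros)
      from DERIV_cdivide[OF DERIV_chain2[where f = "\<lambda>x. calA (lambert_W (lam * x))",
          OF DERIV_calA_lambert_W[OF lam pos'[OF that]] this], of "x - b"]
      show ?thesis
        unfolding has_real_derivative_iff_has_vector_derivative[symmetric] using False by simp
    qed
  qed simp
  moreover have "?g 1 - ?g 0 = W_quotient lam x b"
    using False by (simp add: W_quotient_def diff_divide_distrib)
  ultimately show ?thesis
    by simp
qed

text \<open>
  Integrating the tangent inequality of the slope gives a tangent to \<open>x \<mapsto> W_quotient lam x b\<close>
  at \<open>d\<close>, whose gradient is \<open>s = \<integral>\<^sub>0\<^sup>1 t h'(b + t(d - b)) dt \<le> 0\<close> with \<open>h = W_slope lam\<close>. The identity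
  \<open>f(d) + (d - b) s = h(d)\<close> is the product rule for \<open>(d - b) f(d)\<close>. It determines \<open>s\<close> unless
  \<open>d = b\<close>, which is why the value in that case is recorded separately.
\<close>

lemma W_quotient_tangent:
  assumes lam: "0 < lam" and b: "0 < b" and d: "0 \<le> d"
  obtains s where "s \<le> 0"
    and "\<And>x. 0 \<le> x \<Longrightarrow> W_quotient lam d b + s * (x - d) \<le> W_quotient lam x b"
    and "W_quotient lam d b + (d - b) * s = W_slope lam d"
    and "d = b \<Longrightarrow> s = W_slope_deriv lam b / 2"
proof -
  have pos: "0 \<le> b + t * (x - b)" if "t \<in> {0..1}" "0 \<le> x" for t x
    using segment_nonneg[OF less_imp_le[OF b] that(2,1)] .
  have pos': "0 < b + t * (d - b)" if "t \<in> {0<..<1}" for t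
    using segment_pos[OF b d that] .
  let ?F = "\<lambda>t. t * W_slope_deriv lam (b + t * (d - b))"
  define s where "s = integral {0..1} ?F"
  have "?F integrable_on {0..1}"
    using lam pos[OF _ d] by (intro integrable_continuous_real continuous_intros) auto
  then have s: "(?F has_integral s) {0..1}"
    unfolding s_def by (rule integrable_integral)
  note Q = W_quotient_has_integral[OF lam b]
  show thesis
  proof
    show "s \<le> 0"
      using lam pos[OF _ d] W_slope_deriv_nonpos
      by (intro has_integral_le[OF s has_integral_0]) (auto intro!: mult_nonneg_nonpos)
    show "W_quotient lam d b + s * (x - d) \<le> W_quotient lam x b" if x: "0 \<le> x" for x
    proof (rule has_integral_le)
      show "((\<lambda>t. W_slope lam (b + t * (d - b)) + ?F t * (x - d)) has_integral
          W_quotient lam d b + s * (x - d)) {0..1}"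
        by (intro has_integral_add Q d has_integral_mult_left s)
      show "((\<lambda>t. W_slope lam (b + t * (x - b))) has_integral W_quotient lam x b) {0..1}"
        by (rule Q[OF x])
      show "W_slope lam (b + t * (d - b)) + ?F t * (x - d) \<le> W_slope lam (b + t * (x - b))"
        if "t \<in> {0..1}" for t
        using W_slope_above_tangent[OF lam pos[OF that x] pos[OF that d]]
        by (simp add: algebra_simps)
    qed
    show "W_quotient lam d b + (d - b) * s = W_slope lam d"
    proof (rule has_integral_unique)
      show "((\<lambda>t. W_slope lam (b + t * (d - b)) + (d - b) * ?F t) has_integral
          W_quotient lam d b + (d - b) * s) {0..1}"
        by (intro has_integral_add Q d has_integral_mult_right s)
      \<comment> \<open>The same integrand is the derivative of \<open>t h(b + t(d - b))\<close>.\<close>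
      let ?G = "\<lambda>t. t * W_slope lam (b + t * (d - b))"
      have "((\<lambda>t. W_slope lam (b + t * (d - b)) + (d - b) * ?F t) has_integral (?G 1 - ?G 0)) {0..1}"
      proof (rule fundamental_theorem_of_calculus_interior)
        show "continuous_on {0..1} ?G"
          using lam pos[OF _ d] by (intro continuous_intros) auto
        show "(?G has_vector_derivative W_slope lam (b + t * (d - b)) + (d - b) * ?F t) (at t)"
          if "t \<in> {0<..<1}" for t
        proof -
          have "((\<lambda>t. b + t * (d - b)) has_real_derivative (d - b)) (at t)"
            by (auto intro!: derivative_eq_intros)
          from DERIV_mult[OF DERIV_ident DERIV_chain2[where f = "W_slope lam",
              OF DERIV_W_slope[OF lam pos'[OF that]] this]]
          show ?thesis
            unfolding has_real_derivative_iff_has_vector_derivative[symmetric]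
            by (simp add: algebra_simps)
        qed
      qed simp
      then show "((\<lambda>t. W_slope lam (b + t * (d - b)) + (d - b) * ?F t) has_integral W_slope lam d) {0..1}"
        by simp
    qed
    show "s = W_slope_deriv lam b / 2" if "d = b"
    proof (rule has_integral_unique)
      show "((\<lambda>t. t * W_slope_deriv lam b) has_integral s) {0..1}"
        using s that by simp
      have "((\<lambda>t::real. t) has_integral 1 / 2) {0..1}"
        using ident_has_integral[of 0 "1 :: real"] by simp
      from has_integral_mult_left[OF this]
      show "((\<lambda>t. t * W_slope_deriv lam b) has_integral W_slope_deriv lam b / 2) {0..1}"
        by simp
    qed
  qed
qed

section \<open>The differential inequality\<close>

text \<open>
  Write \<open>L(\<delta>)\<close> for the last factor on the right; then \<open>y = L'\<close> is the base of the square on the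
  left. With \<open>D = 2b + \<beta>e\<^sup>\<delta>\<close>, the function \<open>Q = L - y\<^sup>2/D\<close> vanishes at \<open>0\<close>, and its derivative factors
  as \<open>Q' = y (4b(b-1) - \<beta>e\<^sup>\<delta>(2 + \<beta> - \<delta>)) / D\<^sup>2\<close>. Since \<open>2 + \<beta> - \<delta> \<le> 2e\<^bsup>\<beta>-\<delta>\<^esup>\<close>, the bound on \<open>\<beta>e\<^sup>\<beta>\<close> makes
  the bracket nonnegative. Hence \<open>Q'\<close> has the sign of \<open>y\<close>, which is that of \<open>\<delta>\<close>, and \<open>Q \<ge> 0\<close>.
\<close>

lemma exp_remainder_square_bound:
  fixes b \<beta> \<delta> :: real
  assumes b: "1 \<le> b" and \<beta>: "0 < \<beta>" and \<delta>: "\<delta> \<le> \<beta>" and le: "\<beta> * exp \<beta> \<le> 2 * b * (b - 1)"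
  shows "(\<beta> * (exp \<delta> - 1) + \<delta>)\<^sup>2
    \<le> (2 * b + \<beta> * exp \<delta>) * (\<beta> * (exp \<delta> - 1 - \<delta>) + \<delta>\<^sup>2 / 2)"
proof -
  define L y D where "L = (\<lambda>x. \<beta> * (exp x - 1 - x) + x\<^sup>2 / 2)"
    and "y = (\<lambda>x. \<beta> * (exp x - 1) + x)" and "D = (\<lambda>x. 2 * b + \<beta> * exp x)"
  define Q where "Q = (\<lambda>x. L x - (y x)\<^sup>2 / D x)"
  define Q' where "Q' = (\<lambda>x. y x * (4 * b * (b - 1) - \<beta> * exp x * (2 + (\<beta> - x))) / (D x)\<^sup>2)"
  have D: "0 < D x" for x
    using b \<beta> by (simp add: D_def add_pos_pos)
  have dQ: "(Q has_real_derivative Q' x) (at x)" for x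
  proof -
    have "(L has_real_derivative y x) (at x)"
      unfolding L_def y_def by (auto intro!: derivative_eq_intros simp: algebra_simps)
    moreover have "(y has_real_derivative \<beta> * exp x + 1) (at x)"
      unfolding y_def by (auto intro!: derivative_eq_intros)
    moreover have "(D has_real_derivative \<beta> * exp x) (at x)"
      unfolding D_def by (auto intro!: derivative_eq_intros)
    ultimately have "(Q has_real_derivative
        y x - (2 * y x * (\<beta> * exp x + 1) * D x - (y x)\<^sup>2 * (\<beta> * exp x)) / (D x * D x)) (at x)"
      unfolding Q_def using D[of x] by (auto intro!: derivative_eq_intros)
    moreover have "y x - (2 * y x * (\<beta> * exp x + 1) * D x - (y x)\<^sup>2 * (\<beta> * exp x)) / (D x * D x)
        = y x * (D x * D x - 2 * (\<beta> * exp x + 1) * D x + y x * (\<beta> * exp x)) / (D x)\<^sup>2"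
      using D[of x] by (simp add: field_simps power2_eq_square)
    moreover have "D x * D x - 2 * (\<beta> * exp x + 1) * D x + y x * (\<beta> * exp x)
        = 4 * b * (b - 1) - \<beta> * exp x * (2 + (\<beta> - x))"
      by (simp add: D_def y_def algebra_simps)
    ultimately show ?thesis
      by (simp add: Q'_def)
  qed
  have br: "0 \<le> 4 * b * (b - 1) - \<beta> * exp x * (2 + (\<beta> - x))" if "x \<le> \<beta>" for x
  proof -
    have "2 + (\<beta> - x) \<le> 2 * exp (\<beta> - x)"
      using exp_ge_add_one_self[of "\<beta> - x"] that by linarith
    then have "\<beta> * exp x * (2 + (\<beta> - x)) \<le> \<beta> * exp x * (2 * exp (\<beta> - x))"
      using \<beta> by (intro mult_left_mono) auto
    also have "\<dots> = 2 * (\<beta> * exp \<beta>)"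
      by (simp add: exp_diff)
    finally show ?thesis
      using le by linarith
  qed
  have Q0: "Q 0 = 0"
    by (simp add: Q_def L_def y_def)
  have "0 \<le> Q \<delta>"
  proof (cases "0 \<le> \<delta>")
    case True
    have "0 \<le> Q' x" if "0 \<le> x" "x \<le> \<delta>" for x
      using that \<delta> \<beta> br[of x] by (auto simp: Q'_def y_def intro!: divide_nonneg_nonneg mult_nonneg_nonneg)
    then show ?thesis
      using DERIV_nonneg_imp_nondecreasing[OF True, of Q] dQ Q0 by metis
  next
    case False
    have "Q' x \<le> 0" if "x \<le> 0" for x
    proof -
      have "y x \<le> 0"
        using that \<beta> by (auto simp: y_def intro!: add_nonpos_nonpos mult_nonneg_nonpos)
      then show ?thesis
        using that \<beta> br[of x] by (auto simp: Q'_def intro!: divide_nonpos_nonneg mult_nonpos_nonneg)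
    qed
    then show ?thesis
      using DERIV_nonpos_imp_nonincreasing[of \<delta> 0 Q] dQ Q0 False by (metis linear)
  qed
  then show ?thesis
    using D[of \<delta>] by (simp add: Q_def L_def y_def D_def field_simps)
qed

text \<open>
  How fast the quotient must decrease. With \<open>\<beta> = W(\<lambda>b)\<close> and \<open>\<delta> = \<beta> - W(\<lambda>d)\<close>, the relations
  \<open>b h = \<beta>e\<^sup>\<delta>\<close> and \<open>d h = \<beta> - \<delta>\<close> for \<open>h = W_slope lam d\<close> turn the claim, multiplied by \<open>(d - b)\<^sup>2\<close>,
  into the preceding inequality. The hypothesis \<open>\<lambda> \<le> 2(b - 1)\<close> becomes \<open>\<beta>e\<^sup>\<beta> \<le> 2b(b - 1)\<close>.
\<close>

lemma W_quotient_slope_bound: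
  assumes lam: "0 < lam" and b: "1 \<le> b" and lam_le: "lam \<le> 2 * (b - 1)" and d: "0 \<le> d"
    and s: "W_quotient lam d b + (d - b) * s = W_slope lam d"
    and s_eq: "d = b \<Longrightarrow> s = W_slope_deriv lam b / 2"
  shows "(W_slope lam d)\<^sup>2 \<le> - (b * s) * (2 + W_slope lam d)"
proof -
  define \<beta> u where "\<beta> = lambert_W (lam * b)" and "u = lambert_W (lam * d)"
  let ?h = "W_slope lam d"
  have u: "0 \<le> u" and \<beta>e: "\<beta> * exp \<beta> = lam * b"
    using lambert_W[of "lam * b"] lambert_W[of "lam * d"] lam b d by (auto simp: \<beta>_def u_def)
  have \<beta>: "0 < \<beta>"
    using lambert_W(1)[of "lam * b"] \<beta>e lam b by (cases "\<beta> = 0") (auto simp: \<beta>_def)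
  have le: "\<beta> * exp \<beta> \<le> 2 * b * (b - 1)"
    using mult_right_mono[OF lam_le, of b] b by (simp add: \<beta>e algebra_simps)
  have dh: "d * ?h = u"
    using mult_W_slope[OF less_imp_le[OF lam] d] by (simp add: u_def)
  have bh: "b * ?h = \<beta> * exp (\<beta> - u)"
    using \<beta>e unfolding W_slope_def u_def[symmetric] by (simp add: exp_diff exp_minus field_simps)
  have h: "0 \<le> ?h"
    using lam by (simp add: W_slope_nonneg)
  show ?thesis
  proof (cases "d = b")
    case True
    \<comment> \<open>The gradient is now explicit, and the claim reduces to \<open>\<beta> \<le> 2(b - 1)\<close>.\<close>
    have "\<beta> \<le> 2 * (b - 1)"
    proof (rule ccontr)
      assume "\<not> \<beta> \<le> 2 * (b - 1)"
      then have "2 * (b - 1) < \<beta>" and "b < 1 + \<beta>"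
        using b by auto
      moreover from this(2) have "b < exp \<beta>"
        using exp_ge_add_one_self[of \<beta>] by (rule order.strict_trans2)
      ultimately have "2 * (b - 1) * b < \<beta> * exp \<beta>"
        using b by (intro mult_strict_mono') auto
      then show False
        using le by (simp add: algebra_simps)
    qed
    moreover have "b * ?h = \<beta>"
      using bh True by (simp add: \<beta>_def u_def)
    ultimately have *: "2 * (1 + \<beta>) \<le> b * (2 + ?h)"
      by (simp add: algebra_simps)
    have "s = - ?h\<^sup>2 / (2 * (1 + \<beta>))"
      using s_eq[OF True] True by (simp add: W_slope_deriv_def \<beta>_def)
    then have "- (b * s) * (2 + ?h) = ?h\<^sup>2 * ((b * (2 + ?h)) / (2 * (1 + \<beta>)))"
      by simp
    moreover have "1 \<le> (b * (2 + ?h)) / (2 * (1 + \<beta>))"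
      using * \<beta> by (simp add: field_simps)
    then have "?h\<^sup>2 * 1 \<le> ?h\<^sup>2 * ((b * (2 + ?h)) / (2 * (1 + \<beta>)))"
      by (intro mult_left_mono) auto
    ultimately show ?thesis
      by simp
  next
    case False
    define \<delta> where "\<delta> = \<beta> - u"
    have "(d - b) * s = ?h - W_quotient lam d b"
      using s by linarith
    then have "(d - b) * ((d - b) * s) = (d - b) * ?h - (d - b) * W_quotient lam d b"
      by (simp only: right_diff_distrib)
    also have "(d - b) * W_quotient lam d b = calA u - calA \<beta>"
      using False by (simp add: W_quotient_def u_def \<beta>_def)
    also have "(d - b) * ?h - (calA u - calA \<beta>) = - (\<beta> * (exp \<delta> - 1 - \<delta>) + \<delta>\<^sup>2 / 2)"
    proof -
      have slope: "(d - b) * ?h = \<beta> - \<delta> - \<beta> * exp \<delta>"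
        using dh bh by (simp add: \<delta>_def algebra_simps)
      have u_eq: "u = \<beta> - \<delta>"
        by (simp add: \<delta>_def)
      show ?thesis
        unfolding slope u_eq by (simp add: calA_def power2_eq_square field_simps)
    qed
    finally have 1: "(d - b)\<^sup>2 * s = - (\<beta> * (exp \<delta> - 1 - \<delta>) + \<delta>\<^sup>2 / 2)"
      by (simp add: power2_eq_square mult.assoc)
    have 2: "(d - b)\<^sup>2 * ?h\<^sup>2 = (\<beta> * (exp \<delta> - 1) + \<delta>)\<^sup>2"
    proof -
      have "(d - b) * ?h = - (\<beta> * (exp \<delta> - 1) + \<delta>)"
        using dh bh by (simp add: \<delta>_def algebra_simps)
      then show ?thesis
        by (metis power2_minus power_mult_distrib)
    qed
    have "(d - b)\<^sup>2 * (- (b * s) * (2 + ?h)) = - ((d - b)\<^sup>2 * s) * (2 * b + b * ?h)"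
      by (simp add: algebra_simps)
    also have "\<dots> = (2 * b + \<beta> * exp \<delta>) * (\<beta> * (exp \<delta> - 1 - \<delta>) + \<delta>\<^sup>2 / 2)"
      unfolding 1 bh \<delta>_def by simp
    also have "\<dots> \<ge> (d - b)\<^sup>2 * ?h\<^sup>2"
      unfolding 2 using b \<beta> u le by (intro exp_remainder_square_bound) (auto simp: \<delta>_def)
    finally have "(d - b)\<^sup>2 * ?h\<^sup>2 \<le> (d - b)\<^sup>2 * (- (b * s) * (2 + ?h))" .
    then show ?thesis
      by (rule mult_left_le_imp_le) (use False in simp)
  qed
qed

text \<open>
  The inequality that the induction on the graph consumes. Substituting
  \<open>h = f + (d - b) s\<close> and \<open>\<lambda> e\<^bsup>-dh\<^esup> = h\<close>, its right-hand side factors as \<open>e\<^bsup>-(h + bs)\<^esup> (1 + h)\<close>, so it says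
  \<open>h + bs \<le> ln (1 + h)\<close>. The preceding lemma gives \<open>h + bs \<le> 2h/(2 + h)\<close>, which is a standard
  lower bound for \<open>ln (1 + h)\<close>.
\<close>

lemma W_quotient_step:
  assumes lam: "0 < lam" and b: "1 \<le> b" and lam_le: "lam \<le> 2 * (b - 1)" and d: "0 \<le> d"
    and s: "W_quotient lam d b + (d - b) * s = W_slope lam d"
    and s_eq: "d = b \<Longrightarrow> s = W_slope_deriv lam b / 2"
  shows "1 \<le> exp (- W_quotient lam d b - d * s)
    + lam * exp (- (1 + d) * W_quotient lam d b - s * d * (d - (b - 1)))"
proof -
  let ?h = "W_slope lam d" and ?f = "W_quotient lam d b"
  have h: "0 \<le> ?h"
    using lam by (simp add: W_slope_nonneg)
  have "lam * exp (- (d * ?h)) = ?h"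
    using mult_W_slope[of lam d] lam d by (simp add: W_slope_def)
  moreover have "- ?f - d * s = - (?h + b * s)"
    using s by (simp add: algebra_simps)
  moreover have "- (1 + d) * ?f - s * d * (d - (b - 1)) = - (?h + b * s) + - (d * ?h)"
    unfolding s[symmetric] by (simp add: algebra_simps)
  ultimately have eq: "exp (- ?f - d * s) + lam * exp (- (1 + d) * ?f - s * d * (d - (b - 1)))
      = exp (- (?h + b * s)) * (1 + ?h)"
    by (simp only: exp_add) (simp add: distrib_left mult.left_commute)
  have "?h + b * s \<le> 2 * ?h / (2 + ?h)"
    using W_quotient_slope_bound[OF assms] h by (simp add: field_simps power2_eq_square)
  also have "\<dots> \<le> ln (1 + ?h)"
    using ln_inverse_approx_ge[of 1 "1 + ?h"] h by (cases "?h = 0") auto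
  finally have "exp (?h + b * s) \<le> 1 + ?h"
    using h by (simp add: ln_ge_iff)
  from mult_left_mono[OF this, of "exp (- (?h + b * s))"] show ?thesis
    unfolding eq by (simp add: mult_exp_exp)
qed

section \<open>Degree sums of induced subgraphs\<close>

text \<open>
  Edges are counted by real-valued sums over ordered pairs, because these split along any partition
  of the vertex set and can be reordered.
\<close>

definition adj :: "'a edge set \<Rightarrow> 'a \<Rightarrow> 'a \<Rightarrow> real" where
  "adj E x y = of_bool ({x, y} \<in> E)"

definition deg_in :: "'a edge set \<Rightarrow> 'a set \<Rightarrow> 'a \<Rightarrow> real" where
  "deg_in E S v = (\<Sum>y\<in>S. adj E v y)"

definition deg_sum :: "'a edge set \<Rightarrow> 'a set \<Rightarrow> real" where
  "deg_sum E S = (\<Sum>v\<in>S. deg_in E S v)"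

lemma adj_commute: "adj E x y = adj E y x"
  by (simp add: adj_def insert_commute)

lemma deg_in_eq_card:
  assumes "finite S"
  shows "deg_in E S v = real (card (S \<inter> neighbors E v))"
proof -
  have "S \<inter> neighbors E v = {y \<in> S. {v, y} \<in> E}"
    by (auto simp: neighbors_def insert_commute)
  then show ?thesis
    using assms by (simp add: deg_in_def adj_def of_bool_def sum.If_cases Int_def)
qed

lemma deg_sum_nonneg: "0 \<le> deg_sum E S"
  by (simp add: deg_sum_def deg_in_def adj_def sum_nonneg)

text \<open>The handshake lemma, by counting the incidences between vertices and edges in two ways.\<close>

lemma deg_sum_eq_card_edges:
  assumes "simple_graph V E" and "U \<subseteq> V"
  shows "deg_sum E U = 2 * real (card (induced_edges E U))"
proof -
  let ?F = "induced_edges E U"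
  have fin: "finite U" "finite ?F"
    using assms finite_edges[OF assms(1)] finite_subset
    by (auto simp: simple_graph_def induced_edges_def)
  have two: "card {v \<in> U. v \<in> e} = 2" if "e \<in> ?F" for e
  proof -
    have "{v \<in> U. v \<in> e} = e"
      using that by (auto simp: induced_edges_def)
    then show ?thesis
      using that assms(1) by (auto simp: induced_edges_def simple_graph_def)
  qed
  have deg: "card {e \<in> ?F. v \<in> e} = card (U \<inter> neighbors E v)" if v: "v \<in> U" for v
  proof (rule bij_betw_same_card[symmetric, of "\<lambda>y. {v, y}"], rule bij_betwI')
    fix x y assume "x \<in> U \<inter> neighbors E v" "y \<in> U \<inter> neighbors E v"
    show "({v, x} = {v, y}) = (x = y)"
      by (auto simp: doubleton_eq_iff)
  next
    fix y assume "y \<in> U \<inter> neighbors E v"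
    then show "{v, y} \<in> {e \<in> ?F. v \<in> e}"
      using v by (auto simp: neighbors_def induced_edges_def insert_commute)
  next
    fix e assume e: "e \<in> {e \<in> ?F. v \<in> e}"
    then have "card e = 2"
      using assms(1) by (auto simp: induced_edges_def simple_graph_def)
    then obtain y where "e = {v, y}"
      using e by (auto simp: card_2_iff)
    then show "\<exists>y \<in> U \<inter> neighbors E v. e = {v, y}"
      using e by (auto simp: neighbors_def induced_edges_def insert_commute)
  qed
  have "deg_sum E U = real (\<Sum>v\<in>U. card {e \<in> ?F. v \<in> e})"
    using fin(1) deg by (simp add: deg_sum_def deg_in_eq_card)
  also have "(\<Sum>v\<in>U. card {e \<in> ?F. v \<in> e}) = (\<Sum>e\<in>?F. 2)"
    using fin two by (intro sum_multicount_gen) auto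
  finally show ?thesis
    by simp
qed

text \<open>
  Twice the sum of the degrees over \<open>T\<close> counts every ordered adjacent pair that meets \<open>T\<close>, and it
  counts the pairs inside \<open>T\<close> twice, which the last term corrects.
\<close>

lemma deg_sum_Diff:
  assumes "finite S" and "T \<subseteq> S"
  shows "deg_sum E (S - T) = deg_sum E S - 2 * (\<Sum>u\<in>T. deg_in E S u) + deg_sum E T"
proof -
  have split: "(\<Sum>y\<in>S. f y) = (\<Sum>y\<in>S - T. f y) + (\<Sum>y\<in>T. f y)" for f :: "'a \<Rightarrow> real"
    using assms by (simp add: sum.subset_diff)
  have "(\<Sum>x\<in>S - T. \<Sum>y\<in>T. adj E x y) = (\<Sum>x\<in>T. \<Sum>y\<in>S - T. adj E x y)"
    by (subst sum.swap) (simp add: adj_commute)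
  then show ?thesis
    by (simp add: deg_sum_def deg_in_def split sum.distrib)
qed

section \<open>Induction on induced subgraphs\<close>

lemma indep_poly_empty: "indep_poly {} E lam = 1"
proof -
  have "independent_sets {} E = {{}}"
    by (auto simp: independent_sets_def)
  then show ?thesis
    by (simp add: indep_poly_def)
qed

lemma finite_independent_sets: "finite S \<Longrightarrow> finite (independent_sets S E)"
  by (rule finite_subset[of _ "Pow S"]) (auto simp: independent_sets_def)

text \<open>An independent set avoids \<open>v\<close>, or contains \<open>v\<close> and otherwise avoids \<open>v\<close> and its neighbours.\<close>

lemma indep_poly_recurrence:
  assumes "finite S" and v: "v \<in> S" and loop: "{v} \<notin> E"
  shows "indep_poly S E lam =
    indep_poly (S - {v}) E lam + lam * indep_poly (S - neighbors E v - {v}) E lam"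
proof -
  let ?A = "independent_sets (S - {v}) E" and ?B = "independent_sets (S - neighbors E v - {v}) E"
  have split: "independent_sets S E = ?A \<union> insert v ` ?B"
  proof (intro equalityI subsetI)
    fix I assume I: "I \<in> independent_sets S E"
    show "I \<in> ?A \<union> insert v ` ?B"
    proof (cases "v \<in> I")
      case True
      then have "I = insert v (I - {v})" "I - {v} \<in> ?B"
        using I by (auto simp: independent_sets_def neighbors_def)
      then show ?thesis
        by blast
    next
      case False
      then show ?thesis
        using I by (auto simp: independent_sets_def)
    qed
  next
    fix I assume "I \<in> ?A \<union> insert v ` ?B"
    then show "I \<in> independent_sets S E"
      using v loop by (auto simp: independent_sets_def neighbors_def insert_commute)
  qed
  have inj: "inj_on (insert v) ?B"
    by (auto simp: inj_on_def independent_sets_def)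
  have card: "card (insert v I) = Suc (card I)" if "I \<in> ?B" for I
    using that assms(1) finite_subset by (fastforce simp: independent_sets_def intro: card_insert_disjoint)
  have "?A \<inter> insert v ` ?B = {}"
    by (auto simp: independent_sets_def)
  then have "indep_poly S E lam = (\<Sum>I\<in>?A. lam ^ card I) + (\<Sum>I\<in>insert v ` ?B. lam ^ card I)"
    unfolding indep_poly_def split using assms(1)
    by (intro sum.union_disjoint) (auto simp: finite_independent_sets)
  also have "(\<Sum>I\<in>insert v ` ?B. lam ^ card I) = (\<Sum>I\<in>?B. lam * lam ^ card I)"
    using inj card by (simp add: sum.reindex)
  finally show ?thesis
    by (simp add: indep_poly_def sum_distrib_left)
qed

text \<open>
  The form in which sparsity enters the induction: quantified over all \<open>U\<close>, it is inherited by
  every induced subgraph.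
\<close>

lemma deg_sum_le_of_mad:
  assumes G: "simple_graph V E" and mad: "mad (neighbors E v) (induced_edges E (neighbors E v)) \<le> a"
    and U: "U \<subseteq> neighbors E v"
  shows "deg_sum E U \<le> a * real (card U)"
proof (cases "U = {}")
  case True
  then show ?thesis
    by (simp add: deg_sum_def)
next
  case False
  let ?N = "neighbors E v"
  let ?avg = "\<lambda>(U, F). average_degree U F"
  have N: "?N \<subseteq> V"
    using G by (auto simp: simple_graph_def neighbors_def)
  have "finite V"
    using G by (simp add: simple_graph_def)
  then have fin: "finite ?N" "finite U"
    using N U by (meson finite_subset)+
  have simple: "simple_graph S (induced_edges E S)" if "S \<subseteq> ?N" for S
    using that G fin(1) finite_subset by (auto simp: simple_graph_def induced_edges_def)
  have "(U, induced_edges E U) \<in> nonempty_subgraphs ?N (induced_edges E ?N)"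
    using False U simple[OF U] by (auto simp: nonempty_subgraphs_def induced_edges_def)
  then have "?avg (U, induced_edges E U) \<le> Max (?avg ` nonempty_subgraphs ?N (induced_edges E ?N))"
    using finite_nonempty_subgraphs[OF simple[OF order_refl]] by (intro Max_ge) auto
  also have "\<dots> \<le> a"
  proof -
    have "?N \<noteq> {}"
      using False U by blast
    then show ?thesis
      using mad by (simp add: mad_def)
  qed
  finally show ?thesis
    using deg_sum_eq_card_edges[OF G, of U] U N False fin
    by (simp add: average_degree_def card_gt_0_iff field_simps)
qed

text \<open>Jensen's inequality for \<open>exp\<close>, with a lower bound \<open>c\<close> in place of the mean.\<close>

lemma sum_exp_ge:
  fixes A :: "'a \<Rightarrow> real"
  assumes "real (card S) * c \<le> (\<Sum>v\<in>S. A v)"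
  shows "real (card S) * exp c \<le> (\<Sum>v\<in>S. exp (A v))"
proof -
  have "exp c * (1 + (A v - c)) \<le> exp (A v)" for v
    using mult_left_mono[OF exp_ge_add_one_self[of "A v - c"], of "exp c"] by (simp add: mult_exp_exp)
  then have "(\<Sum>v\<in>S. exp c * (1 + (A v - c))) \<le> (\<Sum>v\<in>S. exp (A v))"
    by (intro sum_mono)
  moreover have "(\<Sum>v\<in>S. exp c * (1 + (A v - c)))
      = real (card S) * exp c + exp c * ((\<Sum>v\<in>S. A v) - real (card S) * c)"
    by (simp only: sum_distrib_left[symmetric] sum.distrib sum_subtractf sum_constant)
      (simp add: algebra_simps)
  moreover have "0 \<le> exp c * ((\<Sum>v\<in>S. A v) - real (card S) * c)"
    using assms by simp
  ultimately show ?thesis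
    by linarith
qed

text \<open>
  Shearer's averaging argument. Replacing \<open>f\<close> by its tangent at the average degree \<open>d\<close> makes the
  inductive bounds for \<open>S - v\<close> and \<open>S - N[v]\<close> affine in the number of vertices and edges that are
  removed. They become \<open>e\<^bsup>n f(d)\<^esup>\<close> times \<open>e\<^bsup>A(v)\<^esup>\<close> and \<open>e\<^bsup>B(v)\<^esup>\<close>, where \<open>A\<close> and \<open>B\<close> involve only the degree of
  \<open>v\<close> and the degree sum over \<open>N(v)\<close>. The means of these over \<open>v\<close> are \<open>d\<close> and the mean squared
  degree, which is at least \<open>d\<^sup>2\<close>; since \<open>s \<le> 0\<close>, Jensen's inequality reduces the induction step to
  the inequality assumed of \<open>f\<close>.
\<close>

lemma shearer_induction:
  fixes f :: "real \<Rightarrow> real"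
  assumes fin: "finite S" and lam: "0 \<le> lam" and loop: "\<And>v. {v} \<notin> E"
    and sparse: "\<And>v U. v \<in> S \<Longrightarrow> U \<subseteq> S \<inter> neighbors E v \<Longrightarrow> deg_sum E U \<le> a * real (card U)"
    and f: "\<And>d. 0 \<le> d \<Longrightarrow> \<exists>s\<le>0. (\<forall>x\<ge>0. f d + s * (x - d) \<le> f x) \<and>
      1 \<le> exp (- f d - d * s) + lam * exp (- (1 + d) * f d - s * d * (d - (a + 1)))"
  shows "exp (real (card S) * f (deg_sum E S / real (card S))) \<le> indep_poly S E lam"
  using fin sparse
proof (induction S rule: finite_psubset_induct)
  case (psubset S)
  show ?case
  proof (cases "S = {}")
    case True
    then show ?thesis
      by (simp add: indep_poly_empty)
  next
    case False
    define n m d where "n = real (card S)" and "m = deg_sum E S" and "d = m / n"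
    have n: "0 < n"
      using False psubset.hyps by (simp add: n_def card_gt_0_iff)
    have m: "0 \<le> m"
      by (simp add: m_def deg_sum_nonneg)
    have d: "0 \<le> d" and nd: "n * d = m"
      using n m by (simp_all add: d_def)
    obtain s where s: "s \<le> 0" and tangent: "\<And>x. 0 \<le> x \<Longrightarrow> f d + s * (x - d) \<le> f x"
      and step: "1 \<le> exp (- f d - d * s) + lam * exp (- (1 + d) * f d - s * d * (d - (a + 1)))"
      using f[OF d] by blast
    have IH: "exp (real (card T) * f d + s * (deg_sum E T - real (card T) * d)) \<le> indep_poly T E lam"
      if "T \<subset> S" for T
    proof -
      let ?k = "real (card T)"
      have "?k * f d + s * (deg_sum E T - ?k * d) \<le> ?k * f (deg_sum E T / ?k)"
      proof (cases "T = {}")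
        case True
        then show ?thesis
          by (simp add: deg_sum_def)
      next
        case False
        then have k: "0 < ?k"
          using that psubset.hyps by (meson card_gt_0_iff finite_subset of_nat_0_less_iff psubset_imp_subset)
        have "?k * (f d + s * (deg_sum E T / ?k - d)) \<le> ?k * f (deg_sum E T / ?k)"
          using k tangent[of "deg_sum E T / ?k"] by (simp add: deg_sum_nonneg)
        then show ?thesis
          using k by (simp add: algebra_simps)
      qed
      also have "exp \<dots> \<le> indep_poly T E lam"
        using that psubset.prems by (intro psubset.IH) blast+
      finally show ?thesis
        by simp
    qed
    let ?deg = "deg_in E S"
    let ?nsum = "\<lambda>v. \<Sum>u\<in>S \<inter> neighbors E v. ?deg u"
    define A where "A = (\<lambda>v. - f d + s * (d - 2 * ?deg v))"
    define B where "B = (\<lambda>v. - (1 + ?deg v) * f d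
      + s * ((1 + ?deg v) * d - 2 * ?nsum v + a * ?deg v))"
    have Z: "exp (n * f d) * (exp (A v) + lam * exp (B v)) \<le> indep_poly S E lam" if v: "v \<in> S" for v
    proof -
      let ?N = "S \<inter> neighbors E v"
      have loops: "deg_sum E {v} = 0"
        using loop by (simp add: deg_sum_def deg_in_def adj_def)
      have nv: "v \<notin> neighbors E v"
        using loop by (simp add: neighbors_def)
      have "real (card (S - {v})) = n - 1"
        using v psubset.hyps n by (simp add: n_def card_gt_0_iff)
          (metis False One_nat_def Suc_leI card_gt_0_iff of_nat_1 of_nat_diff)
      moreover have "deg_sum E (S - {v}) = m - 2 * ?deg v"
        using deg_sum_Diff[OF psubset.hyps(1), of "{v}"] v loops by (simp add: m_def)
      ultimately have "exp ((n - 1) * f d + s * (m - 2 * ?deg v - (n - 1) * d))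
          \<le> indep_poly (S - {v}) E lam"
        using IH[of "S - {v}"] v by auto
      also have "(n - 1) * f d + s * (m - 2 * ?deg v - (n - 1) * d) = n * f d + A v"
        unfolding A_def nd[symmetric] by (simp add: algebra_simps)
      finally have 1: "exp (n * f d) * exp (A v) \<le> indep_poly (S - {v}) E lam"
        by (simp add: exp_add)
      let ?R = "S - neighbors E v - {v}"
      have R: "?R = S - ?N - {v}"
        by blast
      have cN: "real (card ?N) = ?deg v"
        using psubset.hyps by (simp add: deg_in_eq_card)
      have "real (card ?R) = n - (1 + ?deg v)"
      proof -
        have "?R = S - insert v ?N"
          by blast
        then have "card ?R = card S - card (insert v ?N)" "card (insert v ?N) \<le> card S"
          using v psubset.hyps by (auto intro!: card_Diff_subset card_mono)
        moreover have "card (insert v ?N) = Suc (card ?N)"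
          using psubset.hyps nv by simp
        ultimately show ?thesis
          by (simp add: n_def cN[symmetric] of_nat_diff)
      qed
      moreover have "deg_sum E ?R = m - 2 * ?nsum v + deg_sum E ?N"
      proof -
        have "deg_in E (S - ?N) v = 0"
          by (auto simp: deg_in_def adj_def neighbors_def insert_commute)
        then show ?thesis
          unfolding R
          using deg_sum_Diff[of "S - ?N" "{v}" E] deg_sum_Diff[of S ?N E] v nv psubset.hyps loops
          by (simp add: m_def)
      qed
      ultimately have "exp ((n - (1 + ?deg v)) * f d
          + s * (m - 2 * ?nsum v + deg_sum E ?N - (n - (1 + ?deg v)) * d)) \<le> indep_poly ?R E lam"
        using IH[of ?R] v by auto
      \<comment> \<open>The degrees over \<open>N(v)\<close> count the edges inside \<open>N(v)\<close> twice; sparsity bounds the excess.\<close>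
      moreover have "s * (a * ?deg v) \<le> s * deg_sum E ?N"
        using psubset.prems[OF v order_refl] s by (simp add: cN mult_left_mono_neg)
      then have "n * f d + B v \<le> (n - (1 + ?deg v)) * f d
          + s * (m - 2 * ?nsum v + deg_sum E ?N - (n - (1 + ?deg v)) * d)"
        unfolding B_def nd[symmetric] by (simp add: algebra_simps)
      ultimately have "exp (n * f d + B v) \<le> indep_poly ?R E lam"
        by (meson exp_le_cancel_iff order_trans)
      then have 2: "lam * (exp (n * f d) * exp (B v)) \<le> lam * indep_poly ?R E lam"
        using lam by (simp add: exp_add mult_left_mono)
      show ?thesis
        using 1 2 indep_poly_recurrence[OF psubset.hyps(1) v loop, of lam]
        by (simp add: algebra_simps)
    qed
    have sum_deg: "(\<Sum>v\<in>S. ?deg v) = n * d"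
      by (simp add: nd m_def deg_sum_def)
    have sum_A: "n * (- f d - d * s) \<le> (\<Sum>v\<in>S. A v)"
    proof -
      have "(\<Sum>v\<in>S. A v) = n * (- f d) + s * (n * d - 2 * (\<Sum>v\<in>S. ?deg v))"
        by (simp add: A_def sum.distrib sum_subtractf sum_negf sum_distrib_left[symmetric] n_def)
      then show ?thesis
        unfolding sum_deg by (simp add: algebra_simps)
    qed
    \<comment> \<open>Each \<open>u\<close> is a neighbour of \<open>deg u\<close> vertices and so contributes \<open>(deg u)\<^sup>2\<close> in total.\<close>
    have "(\<Sum>v\<in>S. ?nsum v) = (\<Sum>v\<in>S. \<Sum>u\<in>S. adj E v u * ?deg u)"
    proof (rule sum.cong[OF refl])
      fix v
      show "?nsum v = (\<Sum>u\<in>S. adj E v u * ?deg u)"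
        using psubset.hyps
        by (intro sum.mono_neutral_cong_left) (auto simp: adj_def neighbors_def insert_commute)
    qed
    also have "\<dots> = (\<Sum>u\<in>S. (?deg u)\<^sup>2)"
      by (subst sum.swap)
        (simp add: deg_in_def adj_commute power2_eq_square sum_distrib_right[symmetric])
    also have "n * \<dots> \<ge> (n * d)\<^sup>2"
      using sum_squared_le_sum_of_squares[of ?deg S] unfolding sum_deg n_def by (simp add: mult.commute)
    finally have nsum: "n * d\<^sup>2 \<le> (\<Sum>v\<in>S. ?nsum v)"
      using n by (simp add: power2_eq_square ac_simps)
    have sum_B: "n * (- (1 + d) * f d - s * d * (d - (a + 1))) \<le> (\<Sum>v\<in>S. B v)"
    proof -
      have "(\<Sum>v\<in>S. B v) = - (n + (\<Sum>v\<in>S. ?deg v)) * f d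
          + s * ((n + (\<Sum>v\<in>S. ?deg v)) * d - 2 * (\<Sum>v\<in>S. ?nsum v) + a * (\<Sum>v\<in>S. ?deg v))"
        by (simp add: B_def sum.distrib sum_subtractf sum_negf sum_distrib_left[symmetric]
            sum_distrib_right[symmetric] n_def)
      also have "\<dots> \<ge> - (n + n * d) * f d + s * ((n + n * d) * d - 2 * (n * d\<^sup>2) + a * (n * d))"
        unfolding sum_deg using nsum s by (intro add_left_mono mult_left_mono_neg) auto
      finally show ?thesis
        by (simp add: algebra_simps power2_eq_square)
    qed
    have "n * exp (n * f d) * 1 \<le> n * exp (n * f d)
        * (exp (- f d - d * s) + lam * exp (- (1 + d) * f d - s * d * (d - (a + 1))))"
      using n step by (intro mult_left_mono) auto
    also have "\<dots> = exp (n * f d) * (n * exp (- f d - d * s)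
        + lam * (n * exp (- (1 + d) * f d - s * d * (d - (a + 1)))))"
      by (simp add: algebra_simps)
    also have "\<dots> \<le> exp (n * f d) * ((\<Sum>v\<in>S. exp (A v)) + lam * (\<Sum>v\<in>S. exp (B v)))"
      using sum_exp_ge[OF sum_A[unfolded n_def]] sum_exp_ge[OF sum_B[unfolded n_def]] lam
      by (intro mult_left_mono add_mono) (auto simp: n_def)
    also have "\<dots> = (\<Sum>v\<in>S. exp (n * f d) * (exp (A v) + lam * exp (B v)))"
      by (simp add: sum.distrib sum_distrib_left distrib_left)
    also have "\<dots> \<le> (\<Sum>v\<in>S. indep_poly S E lam)"
      using Z by (rule sum_mono)
    also have "\<dots> = n * indep_poly S E lam"
      by (simp add: n_def)
    finally show ?thesis
      using n by (simp add: n_def m_def d_def)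
  qed
qed

section \<open>The lower bound for the independence polynomial\<close>

theorem theorem6:
  fixes a lam d :: real and V :: "'a set" and E :: "'a edge set"
  assumes "0 \<le> a"
    and "simple_graph V E"
    and "V \<noteq> {}"
    and "d = average_degree V E"
    and "\<And>v. v \<in> V \<Longrightarrow> mad (neighbors E v) (induced_edges E (neighbors E v)) \<le> a"
    and "0 \<le> lam"
    and "lam \<le> 2 * (a + 1)"
  shows "ln (indep_poly V E lam) / real (card V) \<ge> W_quotient lam d (a + 2)"
proof -
  let ?f = "\<lambda>x. W_quotient lam x (a + 2)" and ?n = "real (card V)"
  have fin: "finite V" and loop: "{v} \<notin> E" for v
    using assms(2) by (auto simp: simple_graph_def)
  have f: "\<exists>s\<le>0. (\<forall>x\<ge>0. ?f y + s * (x - y) \<le> ?f x) \<and>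
      1 \<le> exp (- ?f y - y * s) + lam * exp (- (1 + y) * ?f y - s * y * (y - (a + 1)))"
    if y: "0 \<le> y" for y
  proof (cases "lam = 0")
    case True
    \<comment> \<open>Here \<open>W\<close> is only evaluated at \<open>0\<close>, so the claimed bound is \<open>0\<close>.\<close>
    then have "?f x = 0" for x
      by (simp add: W_quotient_def lambert_W_eqI[of 0])
    then show ?thesis
      using True by (intro exI[of _ 0]) simp
  next
    case False
    then have lam: "0 < lam"
      using assms(6) by simp
    obtain s where s: "s \<le> 0" "\<And>x. 0 \<le> x \<Longrightarrow> ?f y + s * (x - y) \<le> ?f x"
      "?f y + (y - (a + 2)) * s = W_slope lam y" "y = a + 2 \<Longrightarrow> s = W_slope_deriv lam (a + 2) / 2"
      using W_quotient_tangent[OF lam _ y, of "a + 2"] assms(1) by auto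
    have "1 \<le> exp (- ?f y - y * s) + lam * exp (- (1 + y) * ?f y - s * y * (y - (a + 2 - 1)))"
      using assms(1,7) by (intro W_quotient_step lam y s(3,4)) auto
    moreover have "a + 2 - 1 = a + 1"
      by simp
    ultimately show ?thesis
      using s(1,2) by metis
  qed
  have sparse: "deg_sum E U \<le> a * real (card U)" if "v \<in> V" "U \<subseteq> V \<inter> neighbors E v" for v U
    using that assms(5) by (intro deg_sum_le_of_mad[OF assms(2)]) auto
  have "induced_edges E V = E"
    using assms(2) by (auto simp: induced_edges_def simple_graph_def)
  then have "deg_sum E V / ?n = d"
    using deg_sum_eq_card_edges[OF assms(2) order_refl] assms(4) by (simp add: average_degree_def)
  then have Z: "exp (?n * ?f d) \<le> indep_poly V E lam"
    using shearer_induction[OF fin assms(6) loop sparse f] by simp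
  then have "?n * ?f d \<le> ln (indep_poly V E lam)"
    using ln_ge_iff order.strict_trans2[OF exp_gt_zero Z] by blast
  moreover have "0 < ?n"
    using fin assms(3) by (simp add: card_gt_0_iff)
  ultimately show ?thesis
    by (simp add: field_simps)
qed

end
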